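(* Let $(T,X,\mu)$ be an ergodic measure-preserving map $T:X\to X$ of a probability space $(X,\mu)$ which is also a metric space with metric $d$. Suppose that: (exponential decay of correlations) there are constants $C>0$, $0<\alpha<1$ such that for all Lipschitz functions $\phi,\psi$ on $X$ and all $k\ge1$, $$|E(\phi\cdot\psi\circ T^k)-E(\phi)E(\psi)|\le C\alpha^k\,\|\phi\|_{\mathrm{Lip}}\,\|\psi\|_{\mathrm{Lip}};$$ (B) there exist $r_0>0$ and $0<\delta<1$ such that for all $z\in X$ and all $0<\epsilon<r\le r_0$, $$\mu\{x: r<d(x,z)<r+\epsilon\}<\epsilon^{\delta}.$$ Let $p\in X$ and let $B_i=B(p,r_i)$, $i\ge1$, be a decreasing sequence of balls about $p$ with $r_i\to0$ and $\mu(B_i)\ge i^{-1}$ for all $i\ge 1$. Assume also that there is a distribution function $F$ with $\lim_{t\to0^+}F(t)=0$ such that for every $t>0$ $$\lim_{i\to\infty}\mu_{B_i}\{y\in B_i:\tau_{B_i}(y)\,\mu(B_i)<t\}=F(t).$$ Then $$\limsup_{n\to\infty}\frac{S_n(x)}{E_n}\ge1\quad\text{for }\mu\text{-a.e. }x\in X,$$ where $S_n(x)=\sum_{j=1}^{n}1_{B_j}(T^jx)$ and $E_n=\sum_{j=1}^{n}\mu(B_j)$.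
   Context: $E(\phi)=\int_X\phi\,d\mu$. $1_A$ is the indicator function of $A$. $B(p,r)=\{x\in X:d(x,p)<r\}$ is the ball of radius $r$ about $p$; decreasing means $B_{i+1}\subset B_i$. For a set $B$ of positive measure, $\tau_B(y)=\inf\{n\ge1:T^n(y)\in B\}$ for $y\in B$ is the first return time to $B$, and $\mu_B(A)=\mu(A\cap B)/\mu(B)$ is the conditional probability measure on $B$. $\|\cdot\|_{\mathrm{Lip}}$ is the usual Lipschitz norm (sup norm plus Lipschitz constant), and "Lipschitz function" means one with finite norm. Balls are assumed measurable. *)

theory Defs
  imports "HOL-Probability.Probability"
begin

definition measure_preserving_map :: "'a measure \<Rightarrow> ('a \<Rightarrow> 'a) \<Rightarrow> bool" where
  "measure_preserving_map M T \<longleftrightarrow>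
     T \<in> measurable M M \<and> (\<forall>A\<in>sets M. emeasure M (T -` A \<inter> space M) = emeasure M A)"

definition ergodic_map :: "'a measure \<Rightarrow> ('a \<Rightarrow> 'a) \<Rightarrow> bool" where
  "ergodic_map M T \<longleftrightarrow>
     measure_preserving_map M T \<and>
     (\<forall>A\<in>sets M. T -` A \<inter> space M = A \<longrightarrow> measure M A = 0 \<or> measure M A = 1)"

definition lipschitz_fun :: "('a::metric_space \<Rightarrow> real) \<Rightarrow> bool" where
  "lipschitz_fun f \<longleftrightarrow> bounded (range f) \<and> (\<exists>L. L-lipschitz_on UNIV f)"

text \<open>The following is meaningful only for functions satisfying \<^const>\<open>lipschitz_fun\<close>;
  the infimum is the least Lipschitz constant (and is 0 on a one-point space).\<close>

definition lip_norm :: "('a::metric_space \<Rightarrow> real) \<Rightarrow> real" where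
  "lip_norm f = (SUP x. \<bar>f x\<bar>) + Inf {L. L-lipschitz_on UNIV f}"

text \<open>A point that never returns has return time \<open>\<infinity>\<close>, the infimum of the empty set.\<close>

definition return_time :: "('a \<Rightarrow> 'a) \<Rightarrow> 'a set \<Rightarrow> 'a \<Rightarrow> enat" where
  "return_time T B y = (INF n\<in>{n. 1 \<le> n \<and> (T ^^ n) y \<in> B}. enat n)"

text \<open>No one-sided continuity is required, so that the definition covers both conventions
  \<open>F t = P (X \<le> t)\<close> and \<open>F t = P (X < t)\<close>.\<close>

definition distribution_fun :: "(real \<Rightarrow> real) \<Rightarrow> bool" where
  "distribution_fun F \<longleftrightarrow> mono F \<and> (F \<longlongrightarrow> 0) at_bot \<and> (F \<longlongrightarrow> 1) at_top"

text \<open>Only measurable Lipschitz functions are tested: the \<open>\<sigma>\<close>-algebra need not contain all open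
  sets, and the Bochner integral of a non-measurable function is 0 by convention.\<close>

definition exp_decay_of_correlations :: "'a::metric_space measure \<Rightarrow> ('a \<Rightarrow> 'a) \<Rightarrow> bool" where
  "exp_decay_of_correlations M T \<longleftrightarrow>
     (\<exists>C \<alpha>. C > 0 \<and> 0 < \<alpha> \<and> \<alpha> < 1 \<and>
        (\<forall>\<phi> \<psi> :: 'a \<Rightarrow> real. \<forall>k::nat.
           lipschitz_fun \<phi> \<longrightarrow> \<phi> \<in> borel_measurable M \<longrightarrow>
           lipschitz_fun \<psi> \<longrightarrow> \<psi> \<in> borel_measurable M \<longrightarrow> k \<ge> 1 \<longrightarrow>
           \<bar>(\<integral>x. \<phi> x * \<psi> ((T ^^ k) x) \<partial>M) - (\<integral>x. \<phi> x \<partial>M) * (\<integral>x. \<psi> x \<partial>M)\<bar>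
             \<le> C * \<alpha> ^ k * lip_norm \<phi> * lip_norm \<psi>))"

end

theory Submission
  imports Defs "HOL-Real_Asymp.Real_Asymp"
begin

text \<open>
  It suffices to show \<open>E(S\<^sub>n\<^sup>2) \<le> (1 + e) E\<^sub>n\<^sup>2 + O(E\<^sub>n)\<close> for every \<open>e > 0\<close>: then \<open>S\<^sub>n / E\<^sub>n\<close> tends
  to 1 in \<open>L\<^sup>2\<close>, hence almost surely along a subsequence. Consider the pair \<open>i < j\<close> of the events
  \<open>T\<^sup>j x \<in> B\<^sub>j\<close>. If \<open>j - i > D ln i\<close>, replace the balls by Lipschitz cutoffs. Since
  \<open>\<mu>(B\<^sub>i) \<ge> 1/i\<close> and annuli are thin, the radii are at least polynomial in \<open>1/i\<close>, so cutoffs with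
  polynomially growing Lipschitz constants cost only \<open>i\<^sup>-\<^sup>2\<close> in measure, and exponential decay beats
  these constants. If \<open>j - i \<le> D ln i\<close>, nestedness bounds the pair by a return of \<open>B\<^sub>i\<close> to itself;
  as \<open>F(0+) = 0\<close> such early returns have probability \<open>o(\<mu>(B\<^sub>i))\<close>, and there are only
  \<open>D ln i = O(E\<^sub>n)\<close> values of \<open>j\<close>.
\<close>

section \<open>Second moments and the almost sure limsup\<close>

text \<open>Since the first moment is \<open>E n\<close>, the mean squared deviation of
  \<open>S n / E n\<close> from 1 is the second moment over \<open>(E n)\<^sup>2\<close>, minus 1.
  The terms with \<open>K\<close>, which may depend on \<open>e\<close>, vanish after division
  because \<open>E n\<close> diverges. Convergence in mean yields a single subsequence that works
  almost everywhere, which is enough for a limsup.\<close>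

lemma (in prob_space) AE_limsup_ratio_ge_1:
  fixes S :: "nat \<Rightarrow> 'a \<Rightarrow> real" and E :: "nat \<Rightarrow> real"
  assumes int: "\<And>n. integrable M (S n)" and int2: "\<And>n. integrable M (\<lambda>x. (S n x)\<^sup>2)"
    and mean: "\<And>n. expectation (S n) = E n"
    and E: "filterlim E at_top sequentially"
    and bound: "\<And>e. e > 0 \<Longrightarrow> \<exists>K. \<forall>n. expectation (\<lambda>x. (S n x)\<^sup>2) \<le> (1 + e) * (E n)\<^sup>2 + K * E n + K"
  shows "AE x in M. limsup (\<lambda>n. ereal (S n x / E n)) \<ge> 1"
proof -
  define Z where "Z = (\<lambda>n x. (S n x / E n - 1)\<^sup>2)"
  have Z_expand: "Z n x = (S n x)\<^sup>2 / (E n)\<^sup>2 - 2 * (S n x / E n) + 1" for n x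
    by (simp add: Z_def power2_diff power_divide)
  have Z_int: "integrable M (Z n)" for n
    unfolding Z_expand[abs_def] using int int2 by auto
  \<comment> \<open>For \<open>E n = 0\<close> the formula fails: division by zero gives 0, so
    \<open>Z n\<close> is constantly 1 while the right side is -1.\<close>
  have Z_exp: "expectation (Z n) = expectation (\<lambda>x. (S n x)\<^sup>2) / (E n)\<^sup>2 - 1" if "E n > 0" for n
    unfolding Z_expand[abs_def] using int int2 mean that by (simp add: prob_space)
  have "(\<lambda>n. expectation (Z n)) \<longlonglongrightarrow> 0"
  proof (rule tendstoI)
    fix e :: real assume "e > 0"
    \<comment> \<open>Half of \<open>e\<close> pays for the quadratic coefficient, the other half
      for the lower-order terms.\<close>
    then obtain K where K: "\<And>n. expectation (\<lambda>x. (S n x)\<^sup>2) \<le> (1 + e/2) * (E n)\<^sup>2 + K * E n + K"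
      using bound[of "e/2"] by auto
    have "((\<lambda>y. K / y + K / y\<^sup>2) \<longlongrightarrow> 0) at_top"
      by real_asymp
    from filterlim_compose[OF this E]
    have "(\<lambda>n. K / E n + K / (E n)\<^sup>2) \<longlonglongrightarrow> 0" .
    then have "eventually (\<lambda>n. K / E n + K / (E n)\<^sup>2 < e/2) sequentially"
      using \<open>e > 0\<close> by (intro order_tendstoD(2)) auto
    moreover have "eventually (\<lambda>n. E n > 0) sequentially"
      using E by (simp add: filterlim_at_top_dense)
    ultimately show "eventually (\<lambda>n. dist (expectation (Z n)) 0 < e) sequentially"
    proof eventually_elim
      case (elim n)
      have "expectation (Z n) \<ge> 0"
        by (rule integral_nonneg_AE) (simp add: Z_def)
      moreover have "expectation (\<lambda>x. (S n x)\<^sup>2) / (E n)\<^sup>2 \<le> ((1 + e/2) * (E n)\<^sup>2 + K * E n + K) / (E n)\<^sup>2"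
        using K by (intro divide_right_mono) auto
      moreover have "((1 + e/2) * (E n)\<^sup>2 + K * E n + K) / (E n)\<^sup>2 = 1 + e/2 + (K / E n + K / (E n)\<^sup>2)"
        using elim by (simp add: field_simps power2_eq_square)
      ultimately show ?case
        using Z_exp[OF elim(2)] elim by simp
    qed
  qed
  then have "(\<lambda>n. expectation (\<lambda>x. norm (Z n x))) \<longlonglongrightarrow> 0"
    by (simp add: Z_def)
  from tendsto_L1_AE_subseq[OF Z_int this]
  obtain s where s: "strict_mono s" "AE x in M. (\<lambda>n. Z (s n) x) \<longlonglongrightarrow> 0" by auto
  from s(2) show ?thesis
  proof eventually_elim
    case (elim x)
    have "(\<lambda>n. sqrt (Z (s n) x)) \<longlonglongrightarrow> sqrt 0"
      by (intro tendsto_real_sqrt elim)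
    then have "(\<lambda>n. S (s n) x / E (s n) - 1) \<longlonglongrightarrow> 0"
      by (simp add: Z_def tendsto_rabs_zero_iff)
    then have "(\<lambda>n. ereal (S (s n) x / E (s n))) \<longlonglongrightarrow> ereal 1"
      by (simp add: LIM_zero_iff)
    then have "limsup ((\<lambda>n. ereal (S n x / E n)) \<circ> s) = 1"
      by (intro lim_imp_Limsup) (auto simp: o_def one_ereal_def)
    then show ?case
      using limsup_subseq_mono[OF s(1), of "\<lambda>n. ereal (S n x / E n)"] by simp
  qed
qed

text \<open>Only a positive excess of \<open>P i j\<close> over the product matters. By symmetry
  every excess can be charged to the upper triangle, hence the factor 2; the diagonal is charged
  twice as well, which does no harm.\<close>

lemma sum_square_le_sum_upper_triangle:
  fixes P :: "nat \<Rightarrow> nat \<Rightarrow> real"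
  assumes sym: "\<And>i j. P i j = P j i"
  shows "(\<Sum>i=1..n. \<Sum>j=1..n. P i j)
    \<le> (\<Sum>i=1..n. b i)\<^sup>2 + 2 * (\<Sum>i=1..n. \<Sum>j=i..n. max 0 (P i j - b i * b j))"
proof -
  define e where "e i j = (if i \<le> j then max 0 (P i j - b i * b j) else 0)" for i j
  have e_row: "(\<Sum>j=1..n. e i j) = (\<Sum>j=i..n. max 0 (P i j - b i * b j))" if "i \<in> {1..n}" for i
    unfolding e_def using that by (intro sum.mono_neutral_cong_right) auto
  have "P i j \<le> b i * b j + e i j + e j i" for i j
    using sym[of i j] by (auto simp: e_def mult.commute max_def)
  then have "(\<Sum>i=1..n. \<Sum>j=1..n. P i j) \<le> (\<Sum>i=1..n. \<Sum>j=1..n. b i * b j + e i j + e j i)"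
    by (intro sum_mono) auto
  also have "\<dots> = (\<Sum>i=1..n. b i)\<^sup>2 + (\<Sum>i=1..n. \<Sum>j=1..n. e i j) + (\<Sum>i=1..n. \<Sum>j=1..n. e j i)"
    by (simp add: sum.distrib power2_eq_square sum_product)
  also have "(\<Sum>i=1..n. \<Sum>j=1..n. e j i) = (\<Sum>i=1..n. \<Sum>j=1..n. e i j)"
    by (rule sum.swap)
  finally show ?thesis
    using e_row by simp
qed

text \<open>The slack \<open>c\<close> allows each probability to be enlarged before a pair is
  compared with the product; being summable, it changes the square of \<open>E n\<close> only in
  lower order. The excess is controlled row by row, and only from some row on.\<close>

lemma (in prob_space) AE_limsup_count_ratio_ge_1:
  fixes A :: "nat \<Rightarrow> 'a set" and c :: "nat \<Rightarrow> real"
  defines "E \<equiv> \<lambda>n. \<Sum>j=1..n. prob (A j)"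
  assumes A[measurable]: "\<And>i. A i \<in> events"
    and E: "filterlim E at_top sequentially"
    and c: "\<And>i. c i \<ge> 0" "summable c"
    and excess: "\<And>e. e > 0 \<Longrightarrow> \<exists>N K. K \<ge> 0 \<and> (\<forall>n i. N \<le> i \<longrightarrow> i \<le> n \<longrightarrow>
      (\<Sum>j=i..n. max 0 (prob (A i \<inter> A j) - (prob (A i) + c i) * (prob (A j) + c j)))
        \<le> (e * E n + K) * prob (A i) + K * c i)"
  shows "AE x in M. limsup (\<lambda>n. ereal ((\<Sum>j=1..n. indicator (A j) x) / E n)) \<ge> 1"
proof (rule AE_limsup_ratio_ge_1[OF _ _ _ E])
  fix n
  show "integrable M (\<lambda>x. \<Sum>j=1..n. indicator (A j) x :: real)"
    by (intro Bochner_Integration.integrable_sum integrable_real_indicator) (auto simp: emeasure_eq_measure)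
  have sq: "(\<Sum>j=1..n. indicator (A j) x :: real)\<^sup>2 = (\<Sum>i=1..n. \<Sum>j=1..n. indicator (A i \<inter> A j) x)" for x
    by (simp add: power2_eq_square sum_product indicator_inter_arith)
  show "integrable M (\<lambda>x. (\<Sum>j=1..n. indicator (A j) x :: real)\<^sup>2)"
    unfolding sq
    by (intro Bochner_Integration.integrable_sum integrable_real_indicator) (auto simp: emeasure_eq_measure)
  show "expectation (\<lambda>x. \<Sum>j=1..n. indicator (A j) x) = E n"
    unfolding E_def by (subst Bochner_Integration.integral_sum) (auto simp: emeasure_eq_measure)
next
  fix e :: real assume "e > 0"
  \<comment> \<open>Half of \<open>e\<close>, since the triangle sum enters twice.\<close>
  then obtain N K where K: "K \<ge> 0" and NK: "\<And>n i. N \<le> i \<Longrightarrow> i \<le> n \<Longrightarrow>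
      (\<Sum>j=i..n. max 0 (prob (A i \<inter> A j) - (prob (A i) + c i) * (prob (A j) + c j)))
        \<le> (e/2 * E n + K) * prob (A i) + K * c i"
    using excess[of "e/2"] by auto
  define s where "s = suminf c"
  have s: "s \<ge> 0" unfolding s_def using c by (intro suminf_nonneg)
  have c_le: "(\<Sum>j=1..n. c j) \<le> s" for n
    unfolding s_def using c by (intro sum_le_suminf) auto
  have E_nonneg: "E n \<ge> 0" for n
    by (auto simp: E_def intro!: sum_nonneg)
  \<comment> \<open>The two entries are the linear and the constant coefficient of the final
    expansion; one constant dominates both.\<close>
  define K' where "K' = max (2 * s + 2 * real N + 2 * K) (s\<^sup>2 + 2 * K * s)"
  have "expectation (\<lambda>x. (\<Sum>j=1..n. indicator (A j) x)\<^sup>2) \<le> (1 + e) * (E n)\<^sup>2 + K' * E n + K'" for n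
  proof -
    define row where "row i = (\<Sum>j=i..n. max 0 (prob (A i \<inter> A j) - (prob (A i) + c i) * (prob (A j) + c j)))" for i
    \<comment> \<open>Rows below \<open>N\<close> get only this crude bound; at most
      \<open>N\<close> of them occur, so their total is linear in \<open>E n\<close>.\<close>
    have row_small: "row i \<le> E n" if "i \<in> {1..n}" for i
    proof -
      have "row i \<le> (\<Sum>j=i..n. prob (A j))"
        unfolding row_def
      proof (rule sum_mono)
        fix j
        have "prob (A i \<inter> A j) \<le> prob (A j)" by (intro finite_measure_mono) auto
        moreover have "0 \<le> (prob (A i) + c i) * (prob (A j) + c j)" using c by auto
        ultimately show "max 0 (prob (A i \<inter> A j) - (prob (A i) + c i) * (prob (A j) + c j)) \<le> prob (A j)"
          by auto
      qed
      also have "\<dots> \<le> E n" unfolding E_def using that by (intro sum_mono2) auto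
      finally show ?thesis .
    qed
    have "row i \<le> (if i < N then E n else 0) + ((e/2 * E n + K) * prob (A i) + K * c i)" if "i \<in> {1..n}" for i
      using row_small[OF that] NK[of i n] that K c(1)[of i] E_nonneg[of n] \<open>e > 0\<close>
      by (auto simp: row_def intro!: add_nonneg_nonneg add_increasing2)
    then have "(\<Sum>i=1..n. row i) \<le> (\<Sum>i=1..n. (if i < N then E n else 0) + ((e/2 * E n + K) * prob (A i) + K * c i))"
      by (intro sum_mono) auto
    also have "\<dots> = (\<Sum>i=1..n. if i < N then E n else 0) + (e/2 * E n + K) * E n + K * (\<Sum>i=1..n. c i)"
      by (simp add: sum.distrib E_def sum_distrib_left)
    also have "(\<Sum>i=1..n. if i < N then E n else 0) = (\<Sum>i\<in>{1..n} \<inter> {..<N}. E n)"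
      by (subst sum.inter_restrict) (auto intro!: sum.cong)
    also have "\<dots> \<le> (\<Sum>i\<in>{..<N}. E n)"
      using E_nonneg by (intro sum_mono2) auto
    finally have rows: "(\<Sum>i=1..n. row i) \<le> real N * E n + (e/2 * E n + K) * E n + K * s"
      using mult_left_mono[OF c_le[of n] K] by simp
    have "expectation (\<lambda>x. (\<Sum>j=1..n. indicator (A j) x :: real)\<^sup>2)
        = expectation (\<lambda>x. \<Sum>i=1..n. \<Sum>j=1..n. indicator (A i \<inter> A j) x)"
      by (simp add: power2_eq_square sum_product indicator_inter_arith)
    also have "\<dots> = (\<Sum>i=1..n. \<Sum>j=1..n. prob (A i \<inter> A j))"
      by (subst Bochner_Integration.integral_sum | auto simp: emeasure_eq_measure intro!: sum.cong)+
    also have "\<dots> \<le> (\<Sum>i=1..n. prob (A i) + c i)\<^sup>2 + 2 * (\<Sum>i=1..n. row i)"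
      unfolding row_def
      by (rule sum_square_le_sum_upper_triangle) (simp add: Int_commute)
    also have "(\<Sum>i=1..n. prob (A i) + c i) = E n + (\<Sum>i=1..n. c i)"
      by (simp add: E_def sum.distrib)
    also have "(E n + (\<Sum>i=1..n. c i))\<^sup>2 \<le> (E n + s)\<^sup>2"
      using c_le[of n] E_nonneg[of n] sum_nonneg[of "{1..n}" c] c by (intro power_mono) auto
    also have "(E n + s)\<^sup>2 + 2 * (\<Sum>i=1..n. row i) \<le> (E n + s)\<^sup>2 + 2 * (real N * E n + (e/2 * E n + K) * E n + K * s)"
      using rows by simp
    also have "\<dots> = (1 + e) * (E n)\<^sup>2 + (2 * s + 2 * real N + 2 * K) * E n + (s\<^sup>2 + 2 * K * s)"
      by (simp add: power2_eq_square algebra_simps)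
    also have "\<dots> \<le> (1 + e) * (E n)\<^sup>2 + K' * E n + K'"
      unfolding K'_def using E_nonneg[of n] by (intro add_mono mult_right_mono) auto
    finally show ?thesis by simp
  qed
  then show "\<exists>K. \<forall>n. expectation (\<lambda>x. (\<Sum>j=1..n. indicator (A j) x)\<^sup>2) \<le> (1 + e) * (E n)\<^sup>2 + K * E n + K"
    by blast
qed

section \<open>Lipschitz cutoffs of balls\<close>

text \<open>For \<open>e > 0\<close> this is 1 up to distance \<open>s\<close> from
  \<open>p\<close>, then falls with slope \<open>1 / e\<close> to 0 at distance
  \<open>s + e\<close>. It thus lies between the indicators of two concentric balls.\<close>

definition cutoff :: "'a::metric_space \<Rightarrow> real \<Rightarrow> real \<Rightarrow> 'a \<Rightarrow> real" where
  "cutoff p s e x = max 0 (min 1 (1 - (dist x p - s) / e))"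

lemma cutoff_bounds: "0 \<le> cutoff p s e x" "cutoff p s e x \<le> 1"
  by (auto simp: cutoff_def)

lemma indicator_le_cutoff: "e > 0 \<Longrightarrow> indicator (ball p s) x \<le> cutoff p s e x"
  by (auto simp: cutoff_def indicator_def dist_commute field_simps)

lemma cutoff_le_indicator: "e > 0 \<Longrightarrow> cutoff p s e x \<le> indicator (ball p (s + e)) x"
  by (auto simp: cutoff_def indicator_def dist_commute field_simps)

lemma cutoff_lipschitz:
  assumes "e > 0"
  shows "(1/e)-lipschitz_on UNIV (cutoff p s e)"
proof (rule lipschitz_onI)
  fix x y
  have "dist (cutoff p s e x) (cutoff p s e y) \<le> \<bar>(dist x p - s) / e - (dist y p - s) / e\<bar>"
    by (auto simp: cutoff_def dist_real_def)
  also have "\<dots> = \<bar>dist x p - dist y p\<bar> / e"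
    using assms by (simp add: diff_divide_distrib[symmetric])
  also have "\<dots> \<le> dist x y / e"
    using assms abs_dist_diff_le[of x p y] by (intro divide_right_mono) (auto simp: dist_commute)
  finally show "dist (cutoff p s e x) (cutoff p s e y) \<le> 1 / e * dist x y" by simp
qed (use assms in auto)

lemma lipschitz_fun_cutoff: "e > 0 \<Longrightarrow> lipschitz_fun (cutoff p s e)"
  unfolding lipschitz_fun_def
  using cutoff_lipschitz[of e p s] cutoff_bounds[of p s e]
  by (auto intro!: boundedI[where B=1])

lemma lip_norm_le:
  assumes "\<And>x. \<bar>f x\<bar> \<le> b" "L-lipschitz_on UNIV f"
  shows "lip_norm f \<le> b + L"
  unfolding lip_norm_def
proof (rule add_mono)
  show "(SUP x. \<bar>f x\<bar>) \<le> b" using assms by (intro cSUP_least) auto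
  show "Inf {L. L-lipschitz_on UNIV f} \<le> L"
    using assms by (intro cInf_lower bdd_belowI[of _ 0]) (auto simp: lipschitz_on_nonneg)
qed

text \<open>Needed when upper bounds for two Lipschitz norms are multiplied.\<close>

lemma lip_norm_nonneg:
  assumes "lipschitz_fun f"
  shows "lip_norm f \<ge> 0"
proof -
  obtain L b where "L-lipschitz_on UNIV f" "\<And>x. \<bar>f x\<bar> \<le> b"
    using assms unfolding lipschitz_fun_def bounded_iff by auto
  then have "bdd_above (range (\<lambda>x. \<bar>f x\<bar>))" by (auto intro: bdd_aboveI[of _ b])
  then have "\<bar>f undefined\<bar> \<le> (SUP x. \<bar>f x\<bar>)" by (rule cSUP_upper2) auto
  moreover have "Inf {L. L-lipschitz_on UNIV f} \<ge> 0"
    using \<open>L-lipschitz_on UNIV f\<close> by (intro cInf_greatest) (auto simp: lipschitz_on_nonneg)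
  ultimately show ?thesis unfolding lip_norm_def by linarith
qed

lemma lip_norm_cutoff: "e > 0 \<Longrightarrow> lip_norm (cutoff p s e) \<le> 1 + 1 / e"
  using cutoff_bounds[of p s e] by (intro lip_norm_le cutoff_lipschitz) auto

section \<open>Measurability of distances and invariance under iterates\<close>

text \<open>The sublevel sets of the distance to \<open>z\<close> are balls about \<open>z\<close>.
  Continuity would not be enough, as the \<sigma>-algebra is not assumed to contain every open
  set.\<close>

lemma borel_measurable_dist_of_balls:
  fixes M :: "'a::metric_space measure"
  assumes "space M = UNIV" "\<And>z s. ball z s \<in> sets M"
  shows "(\<lambda>x. dist x z) \<in> borel_measurable M"
  unfolding borel_measurable_iff_less
proof
  fix s
  have "{x \<in> space M. dist x z < s} = ball z s" using assms by (auto simp: dist_commute)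
  then show "{x \<in> space M. dist x z < s} \<in> sets M" using assms by simp
qed

lemma measure_preserving_map_funpow:
  assumes "measure_preserving_map M T"
  shows "measure_preserving_map M (T ^^ n)"
proof (induction n)
  case 0
  show ?case
    by (simp add: measure_preserving_map_def Int_absorb2 sets.sets_into_space)
next
  case (Suc n)
  note [measurable] = assms[unfolded measure_preserving_map_def, THEN conjunct1]
    Suc[unfolded measure_preserving_map_def, THEN conjunct1]
  have "emeasure M ((T ^^ Suc n) -` A \<inter> space M) = emeasure M A" if [measurable]: "A \<in> sets M" for A
  proof -
    have "(T ^^ Suc n) -` A \<inter> space M = (T ^^ n) -` (T -` A \<inter> space M) \<inter> space M"
      using measurable_space[of "T ^^ n" M M] by auto
    also have "emeasure M \<dots> = emeasure M (T -` A \<inter> space M)"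
      using Suc measurable_sets[OF _ that, of T M] assms unfolding measure_preserving_map_def by blast
    also have "\<dots> = emeasure M A"
      using assms that unfolding measure_preserving_map_def by auto
    finally show ?thesis .
  qed
  then show ?case
    unfolding measure_preserving_map_def by (auto simp: o_def)
qed


section \<open>Exponential decay against polynomial growth, and row sums\<close>

text \<open>Write \<alpha> as the cube of \<beta>. One factor \<open>\<beta> ^ k\<close> absorbs the
  power of \<open>1 + k\<close>, the second beats the powers of \<open>i\<close> once
  \<open>k\<close> exceeds a multiple of \<open>ln i\<close>, and the third remains, summable over
  \<open>k\<close>. The terms \<open>8 * real i powr \<kappa>\<close> are reciprocals of the cutoff
  widths used later.\<close>

lemma polynomial_times_geometric_bound:
  fixes \<alpha> \<kappa> :: real
  assumes "0 < \<alpha>" "\<alpha> < 1" "0 < \<kappa>"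
  obtains D \<beta> K where "D > 0" "0 < \<beta>" "\<beta> < 1" "K \<ge> 0"
    "\<And>i k :: nat. i \<ge> 1 \<Longrightarrow> real k > D * ln (real i) \<Longrightarrow>
       \<alpha> ^ k * (1 + 8 * real i powr \<kappa>) * (1 + 8 * real (i + k) powr \<kappa>) \<le> K * (1 / (real i)\<^sup>2) * \<beta> ^ k"
proof -
  define \<beta> where "\<beta> = \<alpha> powr (1/3)"
  have \<beta>: "0 < \<beta>" "\<beta> < 1" using assms powr_less_mono2[of "1/3" \<alpha> 1] by (auto simp: \<beta>_def)
  have \<beta>3: "\<beta> * \<beta> * \<beta> = \<alpha>" using assms by (simp add: \<beta>_def powr_add[symmetric])
  have lnb: "ln \<beta> < 0" using \<beta> by simp
  \<comment> \<open>With this choice, \<open>k > D * ln i\<close> forces \<open>\<beta> ^ k\<close>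
    below \<open>i\<close> to the power \<open>- (2 * \<kappa> + 2)\<close>: the part
    \<open>2 * \<kappa>\<close> cancels \<open>x * x\<close>, the part 2 leaves the inverse
    square.\<close>
  define D where "D = (2 * \<kappa> + 2) / (- ln \<beta>)"
  have D: "D > 0" unfolding D_def using assms lnb by (intro divide_pos_pos) auto
  have "(\<lambda>k::nat. (1 + real k) powr \<kappa> * exp (ln \<beta> * real k)) \<longlonglongrightarrow> 0"
    using lnb assms by real_asymp
  then have "Bseq (\<lambda>k::nat. (1 + real k) powr \<kappa> * exp (ln \<beta> * real k))"
    by (intro convergent_imp_Bseq) (auto simp: convergent_def)
  then obtain K where K: "K > 0" "\<And>k::nat. \<bar>(1 + real k) powr \<kappa> * exp (ln \<beta> * real k)\<bar> \<le> K"
    by (auto simp: Bseq_def)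
  have exp_pow: "exp (ln \<beta> * real k) = \<beta> ^ k" for k :: nat
    using \<beta> by (simp add: exp_of_nat2_mult)
  have "\<alpha> ^ k * (1 + 8 * real i powr \<kappa>) * (1 + 8 * real (i + k) powr \<kappa>) \<le> (81 * K) * (1 / (real i)\<^sup>2) * \<beta> ^ k"
    if i: "i \<ge> 1" and k: "real k > D * ln (real i)" for i k :: nat
  proof -
    define x where "x = real i powr \<kappa>"
    define y where "y = (1 + real k) powr \<kappa>"
    have x1: "x \<ge> 1" using i assms by (simp add: x_def ge_one_powr_ge_zero)
    have y1: "y \<ge> 1" using assms by (simp add: y_def ge_one_powr_ge_zero)
    \<comment> \<open>This inequality separates the variables \<open>i\<close> and
      \<open>k\<close>.\<close>
    have "real (i + k) \<le> real i * (1 + real k)"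
      using i by (simp add: algebra_simps mult_le_cancel_right1)
    then have "real (i + k) powr \<kappa> \<le> (real i * (1 + real k)) powr \<kappa>"
      using assms by (intro powr_mono2) auto
    also have "\<dots> = x * y" by (simp add: x_def y_def powr_mult)
    finally have z: "real (i + k) powr \<kappa> \<le> x * y" .
    have "1 \<le> x * y" using x1 y1 by (metis mult_le_one mult_mono mult_1 zero_le_one order_trans)
    \<comment> \<open>As \<open>x\<close> and \<open>x * y\<close> are at least 1, each summand 1 is
      absorbed by raising 8 to 9.\<close>
    then have "(1 + 8 * x) * (1 + 8 * real (i + k) powr \<kappa>) \<le> (9 * x) * (9 * (x * y))"
      using z x1 by (intro mult_mono) auto
    then have "\<alpha> ^ k * ((1 + 8 * x) * (1 + 8 * real (i + k) powr \<kappa>)) \<le> \<alpha> ^ k * ((9 * x) * (9 * (x * y)))"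
      using assms by (intro mult_left_mono) auto
    also have "\<dots> = 81 * (y * \<beta> ^ k) * (x * x * \<beta> ^ k) * \<beta> ^ k"
      by (simp add: \<beta>3[symmetric] power_mult_distrib)
    also have "\<dots> \<le> 81 * K * (1 / (real i)\<^sup>2) * \<beta> ^ k"
    proof -
      have "y * \<beta> ^ k \<le> K" using K(2)[of k] by (simp add: exp_pow y_def)
      moreover have "x * x * \<beta> ^ k \<le> 1 / (real i)\<^sup>2"
      proof -
        have "ln \<beta> * real k \<le> ln \<beta> * (D * ln (real i))"
          using k lnb by (intro mult_left_mono_neg) auto
        also have "\<dots> = - (2 * \<kappa> + 2) * ln (real i)"
          using lnb by (simp add: D_def field_simps)
        finally have "\<beta> ^ k \<le> real i powr (- (2 * \<kappa> + 2))"
          using i by (simp add: exp_pow[symmetric] powr_def)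
        then have "x * x * \<beta> ^ k \<le> x * x * real i powr (- (2 * \<kappa> + 2))"
          using x1 by (intro mult_left_mono) auto
        also have "\<dots> = real i powr (-2)"
          by (simp add: x_def powr_add[symmetric])
        also have "\<dots> = 1 / (real i)\<^sup>2"
          using i by (simp add: powr_minus powr_numeral divide_simps)
        finally show ?thesis .
      qed
      ultimately show ?thesis
        using K(1) \<beta> x1 y1 by (intro mult_mono mult_nonneg_nonneg) auto
    qed
    finally show ?thesis by (simp add: x_def mult.assoc)
  qed
  with D \<beta> K show ?thesis by (intro that[of D \<beta> "81 * K"]) auto
qed

text \<open>A row consists of its diagonal term, the short gaps of length at most \<open>g\<close>
  with cost \<open>h\<close> each, and a geometric series over all gaps.\<close>

lemma sum_row_le:
  fixes x :: "nat \<Rightarrow> real"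
  assumes "h \<ge> 0" "g \<ge> 0" "K \<ge> 0" "0 < \<beta>" "\<beta> < 1" "a \<ge> 0"
    and x: "\<And>j. j \<in> {i..n} \<Longrightarrow> x j \<le> (if j = i then a else 0)
      + (if i < j \<and> real (j - i) \<le> g then h else 0) + K * \<beta> ^ (j - i)"
  shows "sum x {i..n} \<le> a + h * g + K / (1 - \<beta>)"
proof -
  have "sum x {i..n} \<le> (\<Sum>j=i..n. (if j = i then a else 0)
      + (if i < j \<and> real (j - i) \<le> g then h else 0) + K * \<beta> ^ (j - i))"
    by (intro sum_mono x)
  also have "\<dots> = (\<Sum>j=i..n. if j = i then a else 0)
      + (\<Sum>j=i..n. if i < j \<and> real (j - i) \<le> g then h else 0) + K * (\<Sum>j=i..n. \<beta> ^ (j - i))"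
    by (simp add: sum.distrib sum_distrib_left)
  also have "(\<Sum>j=i..n. if j = i then a else 0) \<le> a"
    using assms by simp
  also have "(\<Sum>j=i..n. if i < j \<and> real (j - i) \<le> g then h else 0)
      = (\<Sum>j | j \<in> {i..n} \<and> i < j \<and> real (j - i) \<le> g. h)"
    by (subst sum.inter_filter) auto
  also have "\<dots> \<le> h * g"
  proof -
    \<comment> \<open>The gap \<open>j - i\<close> is a positive integer not exceeding
      \<open>g\<close>, and it determines \<open>j\<close>.\<close>
    have "card {j \<in> {i..n}. i < j \<and> real (j - i) \<le> g} \<le> card {1..nat \<lfloor>g\<rfloor>}"
      by (rule card_inj_on_le[where f = "\<lambda>j. j - i"]) (auto simp: inj_on_def le_nat_floor)
    then have "real (card {j \<in> {i..n}. i < j \<and> real (j - i) \<le> g}) \<le> g"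
      using assms(2) by (simp add: le_nat_iff le_floor_iff)
    from mult_left_mono[OF this assms(1)] show ?thesis by (simp add: mult.commute)
  qed
  also have "(\<Sum>j=i..n. \<beta> ^ (j - i)) \<le> 1 / (1 - \<beta>)"
  proof -
    have "(\<Sum>j=i..n. \<beta> ^ (j - i)) = (\<Sum>k\<in>(\<lambda>j. j - i) ` {i..n}. \<beta> ^ k)"
      by (subst sum.reindex) (auto simp: inj_on_def)
    also have "\<dots> \<le> (\<Sum>k. \<beta> ^ k)"
      using assms by (intro sum_le_suminf) (auto simp: summable_geometric)
    also have "\<dots> = 1 / (1 - \<beta>)"
      using assms by (simp add: suminf_geometric)
    finally show ?thesis .
  qed
  finally show ?thesis using assms by (simp add: mult_left_mono)
qed

section \<open>Correlations of concentric balls\<close>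

locale ball_measurable_dynamics = prob_space M for M :: "'a::metric_space measure" +
  fixes T :: "'a \<Rightarrow> 'a"
  assumes space_UNIV: "space M = UNIV"
    and ball_events [measurable]: "\<And>z s. ball z s \<in> events"
    and measure_preserving: "measure_preserving_map M T"
begin

lemma funpow_measurable [measurable]: "(T ^^ k) \<in> measurable M M"
  using measure_preserving_map_funpow[OF measure_preserving] by (simp add: measure_preserving_map_def)

lemma funpow_vimage_events [measurable]: "A \<in> events \<Longrightarrow> (T ^^ k) -` A \<in> events"
  using measurable_sets[OF funpow_measurable] by (simp add: space_UNIV)

lemma prob_funpow_vimage:
  assumes "A \<in> events"
  shows "prob ((T ^^ k) -` A) = prob A"
  using measure_preserving_map_funpow[OF measure_preserving, of k] assms
  by (simp add: measure_preserving_map_def measure_def space_UNIV)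

lemma dist_measurable [measurable]: "(\<lambda>x. dist x z) \<in> borel_measurable M"
  by (intro borel_measurable_dist_of_balls space_UNIV ball_events)

lemma cutoff_measurable [measurable]: "cutoff p s e \<in> borel_measurable M"
  unfolding cutoff_def[abs_def] by measurable

text \<open>The indicators are replaced by cutoffs of widths \<open>e\<close> and \<open>e'\<close>,
  to which the decay applies; the means of the cutoffs are at most the measures of the thickened
  balls, and their Lipschitz norms are at most \<open>1 + 1 / e\<close> and
  \<open>1 + 1 / e'\<close>. The time \<open>k\<close> is fixed, so \<open>c\<close> stands for the
  constant times the decay factor.\<close>

lemma correlation_of_balls:
  assumes decay: "\<And>\<phi> \<psi>. lipschitz_fun \<phi> \<Longrightarrow> \<phi> \<in> borel_measurable M \<Longrightarrow>
           lipschitz_fun \<psi> \<Longrightarrow> \<psi> \<in> borel_measurable M \<Longrightarrow>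
           \<bar>(\<integral>x. \<phi> x * \<psi> ((T ^^ k) x) \<partial>M) - (\<integral>x. \<phi> x \<partial>M) * (\<integral>x. \<psi> x \<partial>M)\<bar>
             \<le> c * lip_norm \<phi> * lip_norm \<psi>"
    and "e > 0" "e' > 0" "c \<ge> 0"
  shows "prob (ball p s \<inter> (T ^^ k) -` ball p s')
    \<le> prob (ball p (s + e)) * prob (ball p (s' + e')) + c * (1 + 1 / e) * (1 + 1 / e')"
proof -
  define \<phi> where "\<phi> = cutoff p s e"
  define \<psi> where "\<psi> = cutoff p s' e'"
  note bounds = cutoff_bounds[of p s e, folded \<phi>_def] cutoff_bounds[of p s' e', folded \<psi>_def]
  have [measurable]: "\<phi> \<in> borel_measurable M" "\<psi> \<in> borel_measurable M"
    by (auto simp: \<phi>_def \<psi>_def)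
  have lip: "lipschitz_fun \<phi>" "lipschitz_fun \<psi>"
    using assms by (auto simp: \<phi>_def \<psi>_def lipschitz_fun_cutoff)
  have ints: "integrable M \<phi>" "integrable M \<psi>" "integrable M (\<lambda>x. \<phi> x * \<psi> ((T ^^ k) x))"
    using bounds by (auto intro!: integrable_const_bound[where B=1] AE_I2 mult_le_one simp: abs_mult)
  have "prob (ball p s \<inter> (T ^^ k) -` ball p s') = (\<integral>x. indicator (ball p s \<inter> (T ^^ k) -` ball p s') x \<partial>M)"
    by simp
  also have "\<dots> \<le> (\<integral>x. \<phi> x * \<psi> ((T ^^ k) x) \<partial>M)"
  proof (rule integral_mono)
    fix x
    have "indicator (ball p s \<inter> (T ^^ k) -` ball p s') x
        = indicator (ball p s) x * (indicator (ball p s') ((T ^^ k) x) :: real)"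
      by (auto simp: indicator_def)
    also have "\<dots> \<le> \<phi> x * \<psi> ((T ^^ k) x)"
      unfolding \<phi>_def \<psi>_def using assms
      by (intro mult_mono indicator_le_cutoff cutoff_bounds) auto
    finally show "indicator (ball p s \<inter> (T ^^ k) -` ball p s') x \<le> \<phi> x * \<psi> ((T ^^ k) x)" .
  qed (auto simp: ints emeasure_eq_measure)
  also have "\<dots> \<le> expectation \<phi> * expectation \<psi> + c * lip_norm \<phi> * lip_norm \<psi>"
    using decay[OF lip(1) _ lip(2)] by auto
  also have "\<dots> \<le> prob (ball p (s + e)) * prob (ball p (s' + e')) + c * (1 + 1 / e) * (1 + 1 / e')"
  proof (intro add_mono mult_mono)
    have "expectation \<phi> \<le> expectation (indicator (ball p (s + e)))"
      using assms ints by (intro integral_mono) (auto simp: \<phi>_def cutoff_le_indicator emeasure_eq_measure)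
    then show "expectation \<phi> \<le> prob (ball p (s + e))" by simp
    have "expectation \<psi> \<le> expectation (indicator (ball p (s' + e')))"
      using assms ints by (intro integral_mono) (auto simp: \<psi>_def cutoff_le_indicator emeasure_eq_measure)
    then show "expectation \<psi> \<le> prob (ball p (s' + e'))" by simp
  qed (use assms bounds lip in \<open>auto simp: \<phi>_def \<psi>_def lip_norm_cutoff lip_norm_nonneg intro!: integral_nonneg_AE\<close>)
  finally show ?thesis .
qed

section \<open>Thin annuli and the size of the radii\<close>

text \<open>The annulus condition is used twice: about a second point \<open>z\<close>, where it
  forces \<open>r i\<close> to be at least polynomially large, and about \<open>p\<close>, where it
  bounds the measure gained by thickening. The first use makes the second annulus admissible, its
  width having to be smaller than its inner radius.\<close>

lemma polynomial_thickening:
  assumes "r\<^sub>0 > 0" "0 < \<delta>"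
    and annuli: "\<And>z s \<epsilon>. 0 < \<epsilon> \<Longrightarrow> \<epsilon> < s \<Longrightarrow> s \<le> r\<^sub>0 \<Longrightarrow>
           prob {x. s < dist x z \<and> dist x z < s + \<epsilon>} < \<epsilon> powr \<delta>"
    and r: "r \<longlonglongrightarrow> 0"
    and large: "\<And>i. i \<ge> 1 \<Longrightarrow> prob (ball p (r i)) \<ge> 1 / real i"
  shows "eventually (\<lambda>i. prob (ball p (r i + real i powr (- 2 / \<delta>) / 8)) \<le> prob (ball p (r i)) + 1 / (real i)\<^sup>2) sequentially"
proof -
  \<comment> \<open>The exponent makes \<open>(2 * \<epsilon> i) powr \<delta>\<close> at most the
    inverse square of \<open>i\<close>; the divisor 8 yields \<open>4 * \<epsilon> i < r i\<close>,
    so that \<open>2 * \<epsilon> i\<close> is less than the inner radius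
    \<open>r i - \<epsilon> i\<close>.\<close>
  define \<epsilon> where "\<epsilon> = (\<lambda>i::nat. real i powr (- 2 / \<delta>) / 8)"
  have \<epsilon>: "\<epsilon> \<longlonglongrightarrow> 0" unfolding \<epsilon>_def using assms(2) by real_asymp
  have annulus_events: "{x. s < dist x z \<and> dist x z < t} \<in> events" for s t z
  proof -
    have "{x \<in> space M. s < dist x z \<and> dist x z < t} \<in> events" by measurable
    then show ?thesis by (simp add: space_UNIV)
  qed
  have "eventually (\<lambda>i. prob (ball p (r i + \<epsilon> i)) \<le> prob (ball p (r i)) + 1 / (real i)\<^sup>2) sequentially"
  proof (cases "\<exists>z. z \<noteq> p \<and> dist z p \<le> r\<^sub>0")
    case False
    \<comment> \<open>Here \<open>p\<close> is isolated and \<open>r i\<close> may decay arbitrarily fast, but the thickened ball is \<open>{p}\<close>.\<close>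
    have "(\<lambda>i. r i + \<epsilon> i) \<longlonglongrightarrow> 0" using tendsto_add[OF r \<epsilon>] by simp
    then have "eventually (\<lambda>i. r i + \<epsilon> i < r\<^sub>0) sequentially"
      using assms(1) by (rule order_tendstoD)
    then show ?thesis
      using eventually_ge_at_top[of 1]
    proof eventually_elim
      case (elim i)
      have "ball p (r i) \<noteq> {}" using large[of i] elim by (intro notI) simp
      then have "p \<in> ball p (r i)" by auto
      moreover have "ball p (r i + \<epsilon> i) \<subseteq> {p}"
        using False elim by (force simp: dist_commute)
      ultimately have "prob (ball p (r i + \<epsilon> i)) \<le> prob (ball p (r i))"
        by (intro finite_measure_mono) auto
      then show ?case by (simp add: add_increasing2)
    qed
  next
    case True
    then obtain z where z: "z \<noteq> p" "dist z p \<le> r\<^sub>0" by auto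
    \<comment> \<open>One third, because the annulus about \<open>z\<close> has inner radius
      \<open>dist z p - r i\<close> and width \<open>2 * r i\<close>.\<close>
    have "eventually (\<lambda>i. r i < dist z p / 3) sequentially"
      using r z by (intro order_tendstoD) auto
    moreover have "eventually (\<lambda>i. r i < r\<^sub>0) sequentially"
      using r assms by (intro order_tendstoD) auto
    ultimately show ?thesis
      using eventually_ge_at_top[of 1]
    proof eventually_elim
      case (elim i)
      have "ball p (r i) \<noteq> {}" using large[of i] elim by (intro notI) simp
      then have ri: "r i > 0" by simp
      \<comment> \<open>The ball lies in a thin annulus around \<open>z\<close>, so its measure bounds \<open>r i\<close> from below.\<close>
      have "ball p (r i) \<subseteq> {x. dist z p - r i < dist x z \<and> dist x z < dist z p - r i + 2 * r i}"
      proof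
        fix x assume "x \<in> ball p (r i)"
        then show "x \<in> {x. dist z p - r i < dist x z \<and> dist x z < dist z p - r i + 2 * r i}"
          using dist_triangle[of z p x] dist_triangle[of x z p] by (simp add: dist_commute)
      qed
      then have "prob (ball p (r i)) \<le> prob {x. dist z p - r i < dist x z \<and> dist x z < dist z p - r i + 2 * r i}"
        by (intro finite_measure_mono annulus_events)
      also have "\<dots> < (2 * r i) powr \<delta>"
        using elim ri z by (intro annuli) auto
      finally have "1 / real i < (2 * r i) powr \<delta>"
        using large[of i] elim by simp
      then have "(1 / real i) powr (1/\<delta>) < ((2 * r i) powr \<delta>) powr (1/\<delta>)"
        using assms(2) by (intro powr_less_mono2) auto
      then have "real i powr (- 1 / \<delta>) < 2 * r i"
        using ri assms(2) elim by (simp add: powr_powr powr_divide powr_minus_divide)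
      moreover have "real i powr (- 2 / \<delta>) \<le> real i powr (- 1 / \<delta>)"
        using elim assms(2) by (intro powr_mono) (auto simp: divide_right_mono)
      ultimately have \<epsilon>r: "4 * \<epsilon> i < r i" by (simp add: \<epsilon>_def)
      have \<epsilon>pos: "\<epsilon> i > 0" using elim by (simp add: \<epsilon>_def)
      \<comment> \<open>Starting below \<open>r i\<close> captures the sphere of radius \<open>r i\<close>, which open annuli at \<open>r i\<close> miss.\<close>
      define R where "R = {x. r i - \<epsilon> i < dist x p \<and> dist x p < r i - \<epsilon> i + 2 * \<epsilon> i}"
      have "ball p (r i + \<epsilon> i) \<subseteq> ball p (r i) \<union> R"
        using \<epsilon>pos by (auto simp: R_def dist_commute)
      then have "prob (ball p (r i + \<epsilon> i)) \<le> prob (ball p (r i) \<union> R)"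
        unfolding R_def by (intro finite_measure_mono sets.Un annulus_events) auto
      also have "\<dots> \<le> prob (ball p (r i)) + prob R"
        unfolding R_def by (intro measure_Un_le annulus_events) auto
      also have "prob R \<le> (2 * \<epsilon> i) powr \<delta>"
        unfolding R_def using elim ri \<epsilon>r \<epsilon>pos by (intro less_imp_le annuli) auto
      also have "\<dots> \<le> (real i powr (- 2 / \<delta>)) powr \<delta>"
        using assms(2) by (intro powr_mono2) (auto simp: \<epsilon>_def)
      also have "\<dots> = 1 / (real i)\<^sup>2"
        using elim assms(2) by (simp only: powr_powr) (simp add: powr_minus powr_numeral divide_simps)
      finally show ?case by simp
    qed
  qed
  then show ?thesis by (simp add: \<epsilon>_def)
qed

section \<open>Early returns\<close>

text \<open>A first return is early exactly when some return is. This form gives measurability and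
  contains each single early return event.\<close>

lemma early_return_eq_Union:
  assumes "prob A > 0"
  shows "{y \<in> A. ennreal_of_enat (return_time T A y) * emeasure M A < ennreal t}
    = (\<Union>k\<in>{k. 1 \<le> k \<and> real k * prob A < t}. A \<inter> (T ^^ k) -` A)"
proof (intro set_eqI iffI)
  fix y assume y: "y \<in> {y \<in> A. ennreal_of_enat (return_time T A y) * emeasure M A < ennreal t}"
  \<comment> \<open>A point that never returns is excluded because \<open>A\<close> has positive
    measure, so its scaled return time is infinite.\<close>
  have "return_time T A y \<noteq> \<infinity>"
  proof
    assume "return_time T A y = \<infinity>"
    then show False using y assms by (simp add: emeasure_eq_measure ennreal_top_mult)
  qed
  then have "enat ` {n. 1 \<le> n \<and> (T ^^ n) y \<in> A} \<noteq> {}"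
    unfolding return_time_def by (metis Inf_empty top_enat_def)
  \<comment> \<open>An infimum of a nonempty set of extended naturals is attained.\<close>
  then have "return_time T A y \<in> enat ` {n. 1 \<le> n \<and> (T ^^ n) y \<in> A}"
    unfolding return_time_def by (meson ex_in_conv imageI wellorder_InfI)
  then obtain k where k: "return_time T A y = enat k" "1 \<le> k" "(T ^^ k) y \<in> A" by auto
  then have "ennreal (real k * prob A) < ennreal t"
    using y by (simp add: emeasure_eq_measure ennreal_mult ennreal_of_nat_eq_real_of_nat)
  then have "real k * prob A < t" by (simp add: ennreal_less_iff)
  with k y show "y \<in> (\<Union>k\<in>{k. 1 \<le> k \<and> real k * prob A < t}. A \<inter> (T ^^ k) -` A)" by auto
next
  fix y assume "y \<in> (\<Union>k\<in>{k. 1 \<le> k \<and> real k * prob A < t}. A \<inter> (T ^^ k) -` A)"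
  then obtain k where k: "1 \<le> k" "real k * prob A < t" "y \<in> A" "(T ^^ k) y \<in> A" by auto
  have "return_time T A y \<le> enat k"
    unfolding return_time_def using k by (intro INF_lower) auto
  then have "ennreal_of_enat (return_time T A y) * emeasure M A \<le> ennreal_of_enat (enat k) * emeasure M A"
    by (intro mult_right_mono iffD2[OF ennreal_of_enat_le_iff]) auto
  also have "\<dots> = ennreal (real k * prob A)"
    by (simp add: emeasure_eq_measure ennreal_mult ennreal_of_nat_eq_real_of_nat)
  also have "\<dots> < ennreal t" using k by (intro ennreal_lessI) (auto intro: le_less_trans[rotated])
  finally show "y \<in> {y \<in> A. ennreal_of_enat (return_time T A y) * emeasure M A < ennreal t}"
    using k by auto
qed

text \<open>Since \<open>F\<close> tends to 0 at 0 from the right, some \<open>t > 0\<close> has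
  \<open>F t < \<eta>\<close>. Eventually the conditional measure of all returns before scaled time
  \<open>t\<close> is below \<eta>, and each single return event is contained in their
  union.\<close>

lemma early_returns_rare:
  assumes A[measurable]: "\<And>i. A i \<in> events" and pos: "eventually (\<lambda>i. prob (A i) > 0) sequentially"
    and F: "(F \<longlongrightarrow> 0) (at_right 0)"
    and return_times: "\<And>t. t > 0 \<Longrightarrow>
           (\<lambda>i. measure (uniform_measure M (A i))
                  {y \<in> A i. ennreal_of_enat (return_time T (A i) y) * emeasure M (A i) < ennreal t})
           \<longlonglongrightarrow> F t"
    and "\<eta> > 0"
  obtains t where "t > 0"
    "eventually (\<lambda>i. \<forall>k\<ge>1. real k * prob (A i) < t \<longrightarrow>
       prob (A i \<inter> (T ^^ k) -` A i) \<le> \<eta> * prob (A i)) sequentially"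
proof -
  have "eventually (\<lambda>t. F t < \<eta> \<and> t > 0) (at_right 0)"
    using order_tendstoD(2)[OF F \<open>\<eta> > 0\<close>] eventually_at_right_less by (rule eventually_conj)
  then obtain t where t: "F t < \<eta>" "t > 0"
    using eventually_happens trivial_limit_at_right_real by blast
  have "eventually (\<lambda>i. \<forall>k\<ge>1. real k * prob (A i) < t \<longrightarrow>
       prob (A i \<inter> (T ^^ k) -` A i) \<le> \<eta> * prob (A i)) sequentially"
    using order_tendstoD(2)[OF return_times[OF t(2)] t(1)] pos
  proof eventually_elim
    case (elim i)
    define R where "R = (\<Union>k\<in>{k. 1 \<le> k \<and> real k * prob (A i) < t}. A i \<inter> (T ^^ k) -` A i)"
    have R[measurable]: "R \<in> events" unfolding R_def by (intro sets.countable_UN'') auto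
    have "measure (uniform_measure M (A i)) R = prob (A i \<inter> R) / prob (A i)"
      using elim(2) by (intro measure_uniform_measure) (auto simp: emeasure_eq_measure)
    moreover have "A i \<inter> R = R" by (auto simp: R_def)
    ultimately have "prob R < \<eta> * prob (A i)"
      using elim(1)[unfolded early_return_eq_Union[OF elim(2)], folded R_def] elim(2)
      by (simp add: pos_divide_less_eq)
    moreover have "prob (A i \<inter> (T ^^ k) -` A i) \<le> prob R" if "k \<ge> 1" "real k * prob (A i) < t" for k
      using that by (intro finite_measure_mono R) (auto simp: R_def)
    ultimately show ?case by fastforce
  qed
  with t show ?thesis by (intro that)
qed

end

section \<open>Long gaps, short gaps and the conclusion\<close>

theorem theorem5p1:
  fixes M :: "'a::metric_space measure"
    and T :: "'a \<Rightarrow> 'a"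
    and r\<^sub>0 \<delta> :: real
    and p :: 'a
    and r :: "nat \<Rightarrow> real"
    and B :: "nat \<Rightarrow> 'a set"
    and F :: "real \<Rightarrow> real"
  assumes "prob_space M"
    and "space M = UNIV"
    and balls_measurable: "\<And>z s. ball z s \<in> sets M"
    and "ergodic_map M T"
    and "exp_decay_of_correlations M T"
    and "r\<^sub>0 > 0" and "0 < \<delta>" and "\<delta> < 1"
    and annuli: "\<And>z s \<epsilon>. 0 < \<epsilon> \<Longrightarrow> \<epsilon> < s \<Longrightarrow> s \<le> r\<^sub>0 \<Longrightarrow>
           measure M {x. s < dist x z \<and> dist x z < s + \<epsilon>} < \<epsilon> powr \<delta>"
    and B_ball: "\<And>i. i \<ge> 1 \<Longrightarrow> B i = ball p (r i)"
    and B_decreasing: "\<And>i. i \<ge> 1 \<Longrightarrow> B (Suc i) \<subseteq> B i"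
    and "r \<longlonglongrightarrow> 0"
    and B_large: "\<And>i. i \<ge> 1 \<Longrightarrow> measure M (B i) \<ge> 1 / real i"
    and "distribution_fun F"
    and "(F \<longlongrightarrow> 0) (at_right 0)"
    and return_times: "\<And>t. t > 0 \<Longrightarrow>
           (\<lambda>i. measure (uniform_measure M (B i))
                  {y \<in> B i. ennreal_of_enat (return_time T (B i) y) * emeasure M (B i) < ennreal t})
           \<longlonglongrightarrow> F t"
  shows "AE x in M.
           limsup (\<lambda>n. ereal ((\<Sum>j=1..n. indicator (B j) ((T ^^ j) x)) / (\<Sum>j=1..n. measure M (B j)))) \<ge> 1"
proof -
  interpret prob_space M by fact
  interpret ball_measurable_dynamics M T
    by unfold_locales (use assms in \<open>auto simp: ergodic_map_def\<close>)
  \<comment> \<open>Nothing is known about \<open>B 0\<close>, not even measurability;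
    \<open>b\<close> is a ball at every index and agrees with \<open>B\<close> from 1 on.\<close>
  define b where "b i = ball p (r i)" for i
  define A where "A i = (T ^^ i) -` b i" for i
  define a where "a i = prob (b i)" for i
  \<comment> \<open>The slack that pays for thickening the balls; \<open>c 0\<close> is 0 by
    division by zero.\<close>
  define c where "c i = 1 / (real i)\<^sup>2" for i
  define E where "E n = (\<Sum>j=1..n. prob (A j))" for n
  have [measurable]: "b i \<in> events" "A i \<in> events" for i
    by (auto simp: A_def b_def)
  have B_eq: "B i = b i" if "i \<ge> 1" for i using B_ball[OF that] by (simp add: b_def)
  have prob_A: "prob (A i) = a i" for i
    by (simp add: A_def a_def prob_funpow_vimage)
  \<comment> \<open>Invariance under the first \<open>i\<close> iterates leaves only the gap
    \<open>j - i\<close>.\<close>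
  have prob_A_Int: "prob (A i \<inter> A j) = prob (b i \<inter> (T ^^ (j - i)) -` b j)" if "i \<le> j" for i j
  proof -
    have "A i \<inter> A j = (T ^^ i) -` (b i \<inter> (T ^^ (j - i)) -` b j)"
    proof -
      have "(T ^^ (j - i)) ((T ^^ i) x) = (T ^^ j) x" for x
        using that funpow_add[of "j - i" i T] by simp
      then show ?thesis by (auto simp: A_def)
    qed
    moreover have "b i \<inter> (T ^^ (j - i)) -` b j \<in> events"
      by (intro sets.Int funpow_vimage_events) auto
    ultimately show ?thesis using prob_funpow_vimage by metis
  qed
  have a_large: "a i \<ge> 1 / real i" if "i \<ge> 1" for i
    using B_large[OF that] B_eq[OF that] by (simp add: a_def)
  have a_pos: "a i > 0" if "i \<ge> 1" for i
    using a_large[OF that] that by (intro less_le_trans[OF _ a_large[OF that]]) auto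
  have b_anti: "b j \<subseteq> b i" if "1 \<le> i" "i \<le> j" for i j
    using that(2)
  proof (induction j rule: dec_induct)
    case (step m)
    then show ?case using B_decreasing[of m] B_eq[of m] B_eq[of "Suc m"] that by auto
  qed simp
  have a_anti: "a j \<le> a i" if "1 \<le> i" "i \<le> j" for i j
    unfolding a_def using b_anti[OF that] by (intro finite_measure_mono) auto
  have a_nonneg: "a i \<ge> 0" for i by (simp add: a_def)
  have E_a: "E n = (\<Sum>j=1..n. a j)" for n by (simp add: E_def prob_A)
  have E_mono: "E i \<le> E n" if "i \<le> n" for i n
    unfolding E_a using that by (intro sum_mono2) (auto simp: a_nonneg)
  \<comment> \<open>Nestedness makes each of the first \<open>i\<close> summands at least
    \<open>a i\<close>.\<close>
  have E_mult: "real i * a i \<le> E i" for i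
  proof -
    have "(\<Sum>j=1..i. a i) \<le> E i" unfolding E_a by (intro sum_mono a_anti) auto
    then show ?thesis by simp
  qed
  \<comment> \<open>Comparison with the harmonic series gives divergence of \<open>E\<close>, and
    later bounds the number of short gaps by a multiple of \<open>E n\<close>.\<close>
  have E_ln: "ln (real n + 1) \<le> E n" for n
  proof -
    have "ln (real n + 1) \<le> harm n" by (rule ln_le_harm)
    also have "\<dots> \<le> E n"
      unfolding harm_def E_a using a_large by (intro sum_mono) (auto simp: divide_simps)
    finally show ?thesis .
  qed
  have E_top: "filterlim E at_top sequentially"
    by (rule filterlim_at_top_mono[of "\<lambda>n. ln (real n + 1)"]) (real_asymp, simp add: E_ln)
  have "AE x in M. limsup (\<lambda>n. ereal ((\<Sum>j=1..n. indicator (A j) x) / (\<Sum>j=1..n. prob (A j)))) \<ge> 1"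
  proof (rule AE_limsup_count_ratio_ge_1)
    show "summable c"
      unfolding c_def using inverse_power_summable[of 2, where 'a=real] by (simp add: inverse_eq_divide)
    show "filterlim (\<lambda>n. \<Sum>j=1..n. prob (A j)) at_top sequentially"
      using E_top unfolding E_def[abs_def] .
  next
    fix e :: real assume "e > 0"
    obtain C \<alpha> where C: "C > 0" and \<alpha>: "0 < \<alpha>" "\<alpha> < 1"
      and decay: "\<And>\<phi> \<psi> k. lipschitz_fun \<phi> \<Longrightarrow> \<phi> \<in> borel_measurable M \<Longrightarrow>
           lipschitz_fun \<psi> \<Longrightarrow> \<psi> \<in> borel_measurable M \<Longrightarrow> k \<ge> 1 \<Longrightarrow>
           \<bar>(\<integral>x. \<phi> x * \<psi> ((T ^^ k) x) \<partial>M) - (\<integral>x. \<phi> x \<partial>M) * (\<integral>x. \<psi> x \<partial>M)\<bar>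
             \<le> C * \<alpha> ^ k * lip_norm \<phi> * lip_norm \<psi>"
      using \<open>exp_decay_of_correlations M T\<close> unfolding exp_decay_of_correlations_def by blast
    obtain D \<beta> K where D: "D > 0" and \<beta>: "0 < \<beta>" "\<beta> < 1" and K: "K \<ge> 0"
      and gap: "\<And>i k. i \<ge> 1 \<Longrightarrow> real k > D * ln (real i) \<Longrightarrow>
        \<alpha> ^ k * (1 + 8 * real i powr (2 / \<delta>)) * (1 + 8 * real (i + k) powr (2 / \<delta>)) \<le> K * (1 / (real i)\<^sup>2) * \<beta> ^ k"
      using polynomial_times_geometric_bound[OF \<alpha>, of "2 / \<delta>"] \<open>0 < \<delta>\<close> by auto
    have "eventually (\<lambda>i. prob (ball p (r i + real i powr (- 2 / \<delta>) / 8)) \<le> prob (ball p (r i)) + 1 / (real i)\<^sup>2) sequentially"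
      using a_large by (intro polynomial_thickening[OF \<open>r\<^sub>0 > 0\<close> \<open>0 < \<delta>\<close> annuli \<open>r \<longlonglongrightarrow> 0\<close>]) (auto simp: a_def b_def)
    then obtain N1 where thick: "\<And>i. i \<ge> N1 \<Longrightarrow> prob (ball p (r i + real i powr (- 2 / \<delta>) / 8)) \<le> a i + c i"
      by (auto simp: eventually_sequentially a_def b_def c_def)
    have pos: "eventually (\<lambda>i. prob (b i) > 0) sequentially"
      using eventually_ge_at_top[of 1] by eventually_elim (use a_pos in \<open>simp add: a_def\<close>)
    have return_times': "(\<lambda>i. measure (uniform_measure M (b i))
        {y \<in> b i. ennreal_of_enat (return_time T (b i) y) * emeasure M (b i) < ennreal t}) \<longlonglongrightarrow> F t"
      if "t > 0" for t
      by (rule Lim_transform_eventually[OF return_times[OF that]])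
        (use eventually_ge_at_top[of 1] in eventually_elim, simp add: B_eq)
    \<comment> \<open>The tolerance \<open>e / D\<close> fits the at most \<open>D * ln i\<close>
      short gaps: together they cost at most \<open>e * a i * ln i\<close>, hence at most
      \<open>e * a i * E n\<close>.\<close>
    obtain t where t: "t > 0" and "eventually (\<lambda>i. \<forall>k\<ge>1. real k * prob (b i) < t \<longrightarrow>
       prob (b i \<inter> (T ^^ k) -` b i) \<le> e / D * prob (b i)) sequentially"
      using early_returns_rare[OF _ pos \<open>(F \<longlongrightarrow> 0) (at_right 0)\<close> return_times', of "e / D"] \<open>e > 0\<close> D by auto
    then obtain N2 where short: "\<And>i k. i \<ge> N2 \<Longrightarrow> k \<ge> 1 \<Longrightarrow> real k * a i < t \<Longrightarrow>
       prob (b i \<inter> (T ^^ k) -` b i) \<le> e / D * a i"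
      by (auto simp: eventually_sequentially a_def)
    \<comment> \<open>When \<open>D * ln i * a i\<close> is at least \<open>t\<close>, this gives
      \<open>D * ln i \<le> e * i * a i\<close>, and then even the trivial bound \<open>a i\<close>
      for every short gap suffices.\<close>
    have "eventually (\<lambda>i::nat. (D * ln (real i))\<^sup>2 \<le> e * t * real i) sequentially"
      using \<open>e > 0\<close> t D by real_asymp
    then obtain N3 where N3: "\<And>i. i \<ge> N3 \<Longrightarrow> (D * ln (real i))\<^sup>2 \<le> e * t * real i"
      by (auto simp: eventually_sequentially)
    \<comment> \<open>The entry 2 makes \<open>ln i\<close> positive, so that \<open>g\<close> below
      can be cancelled.\<close>
    define N where "N = Max {2, N1, N2, N3}"
    \<comment> \<open>For long gaps the summands \<open>c i\<close> and \<open>c j\<close> absorb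
      the thickening, and only the correlation error of the cutoffs is left.\<close>
    have long: "prob (A i \<inter> A j) - (a i + c i) * (a j + c j) \<le> C * K * c i * \<beta> ^ (j - i)"
      if "N \<le> i" "i < j" "real (j - i) > D * ln (real i)" for i j
    proof -
      have ij: "i \<ge> 1" "j \<ge> 1" "i \<ge> N1" "j \<ge> N1" "j - i \<ge> 1" using that by (auto simp: N_def)
      have inv: "1 / (real i powr (- 2 / \<delta>) / 8) = 8 * real i powr (2 / \<delta>)" for i
        by (simp add: powr_minus_divide)
      have "prob (b i \<inter> (T ^^ (j - i)) -` b j)
        \<le> prob (ball p (r i + real i powr (- 2 / \<delta>) / 8)) * prob (ball p (r j + real j powr (- 2 / \<delta>) / 8))
          + C * \<alpha> ^ (j - i) * (1 + 1 / (real i powr (- 2 / \<delta>) / 8)) * (1 + 1 / (real j powr (- 2 / \<delta>) / 8))"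
        unfolding b_def using ij C \<alpha> decay by (intro correlation_of_balls) auto
      also have "\<dots> \<le> (a i + c i) * (a j + c j)
          + C * (\<alpha> ^ (j - i) * (1 + 8 * real i powr (2 / \<delta>)) * (1 + 8 * real j powr (2 / \<delta>)))"
      proof (rule add_mono)
        show "prob (ball p (r i + real i powr (- 2 / \<delta>) / 8)) * prob (ball p (r j + real j powr (- 2 / \<delta>) / 8))
          \<le> (a i + c i) * (a j + c j)"
          using thick ij a_nonneg by (intro mult_mono) (auto simp: c_def)
      qed (simp only: inv mult.assoc order_refl)
      also have "\<dots> \<le> (a i + c i) * (a j + c j) + C * (K * (1 / (real i)\<^sup>2) * \<beta> ^ (j - i))"
        using gap[of i "j - i"] ij that C by (intro add_left_mono mult_left_mono) auto
      finally show ?thesis using that by (simp add: prob_A_Int c_def mult.assoc)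
    qed
    have row: "(\<Sum>j=i..n. max 0 (prob (A i \<inter> A j) - (prob (A i) + c i) * (prob (A j) + c j)))
        \<le> (e * E n + max 1 (C * K / (1 - \<beta>))) * prob (A i) + max 1 (C * K / (1 - \<beta>)) * c i"
      if "N \<le> i" "i \<le> n" for n i
    proof -
      have i: "i \<ge> 2" "i \<ge> N2" "i \<ge> N3" using that by (auto simp: N_def)
      define g where "g = D * ln (real i)"
      have g: "g > 0" using i D by (simp add: g_def)
      \<comment> \<open>The cost of one short gap: if all of them end before scaled time
        \<open>t\<close>, returns are rare; otherwise the trivial bound is taken.\<close>
      define h where "h = (if g * a i < t then e / D * a i else a i)"
      have h: "h \<ge> 0" using a_nonneg[of i] \<open>e > 0\<close> D by (simp add: h_def)
      have "(\<Sum>j=i..n. max 0 (prob (A i \<inter> A j) - (prob (A i) + c i) * (prob (A j) + c j)))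
        \<le> a i + h * g + C * K * c i / (1 - \<beta>)"
      proof (rule sum_row_le)
        fix j assume j: "j \<in> {i..n}"
        have nonneg: "0 \<le> (prob (A i) + c i) * (prob (A j) + c j)" by (simp add: c_def)
        then have le: "max 0 (prob (A i \<inter> A j) - (prob (A i) + c i) * (prob (A j) + c j)) \<le> prob (A i \<inter> A j)"
          using measure_nonneg[of M "A i \<inter> A j"] by linarith
        have rest: "0 \<le> C * K * c i * \<beta> ^ (j - i)" using C K \<beta> by (simp add: c_def)
        consider "j = i" | "i < j" "real (j - i) \<le> g" | "i < j" "real (j - i) > g" using j by force
        then show "max 0 (prob (A i \<inter> A j) - (prob (A i) + c i) * (prob (A j) + c j))
          \<le> (if j = i then a i else 0) + (if i < j \<and> real (j - i) \<le> g then h else 0) + C * K * c i * \<beta> ^ (j - i)"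
        proof cases
          case 1
          then show ?thesis using order_trans[OF le] rest by (simp add: prob_A)
        next
          case 2
          have "prob (A i \<inter> A j) \<le> h"
          proof (cases "g * a i < t")
            case True
            have "real (j - i) * a i \<le> g * a i" using 2 a_nonneg by (intro mult_right_mono) auto
            then have "prob (b i \<inter> (T ^^ (j - i)) -` b i) \<le> e / D * a i"
              using True 2 i by (intro short) auto
            \<comment> \<open>Nestedness turns a visit to the later ball into a return to
              \<open>b i\<close>.\<close>
            moreover have "prob (b i \<inter> (T ^^ (j - i)) -` b j) \<le> prob (b i \<inter> (T ^^ (j - i)) -` b i)"
              using b_anti[of i j] 2 i by (intro finite_measure_mono) auto
            ultimately show ?thesis using 2 True by (simp add: prob_A_Int h_def)
          next
            case False
            have "prob (A i \<inter> A j) \<le> prob (A i)" by (intro finite_measure_mono) auto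
            then show ?thesis using False by (simp add: prob_A h_def)
          qed
          then have "max 0 (prob (A i \<inter> A j) - (prob (A i) + c i) * (prob (A j) + c j)) \<le> h + C * K * c i * \<beta> ^ (j - i)"
            using le rest by linarith
          then show ?thesis using 2 by simp
        next
          case 3
          then have "max 0 (prob (A i \<inter> A j) - (prob (A i) + c i) * (prob (A j) + c j)) \<le> C * K * c i * \<beta> ^ (j - i)"
            using long[of i j] that rest by (simp add: prob_A g_def)
          then show ?thesis using 3 by simp
        qed
      qed (use h g C K \<beta> a_nonneg in \<open>auto simp: c_def\<close>)
      also have "h * g \<le> e * E n * a i"
      proof (cases "g * a i < t")
        case True
        have "ln (real i) \<le> ln (real n + 1)" using i that by simp
        also have "\<dots> \<le> E n" by (rule E_ln)
        finally have "e * a i * ln (real i) \<le> e * a i * E n"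
          using \<open>e > 0\<close> a_nonneg by (intro mult_left_mono) auto
        then show ?thesis using True D by (simp add: h_def g_def mult_ac)
      next
        case False
        \<comment> \<open>Now \<open>a i\<close> is so large that \<open>E n \<ge> i * a i\<close> dominates \<open>g\<close>.\<close>
        have "g * g \<le> e * real i * t" using N3 i by (simp add: g_def power2_eq_square mult_ac)
        also have "\<dots> \<le> e * real i * (g * a i)" using False \<open>e > 0\<close> by (intro mult_left_mono) auto
        finally have "g * g \<le> (e * (real i * a i)) * g" by (simp add: mult_ac)
        then have "g \<le> e * (real i * a i)" using g by simp
        also have "\<dots> \<le> e * E n"
          using E_mult[of i] E_mono[OF that(2)] \<open>e > 0\<close> by (intro mult_left_mono) auto
        finally have "a i * g \<le> a i * (e * E n)" using a_nonneg by (intro mult_left_mono) auto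
        then show ?thesis using False by (simp add: h_def mult_ac)
      qed
      also have "a i + e * E n * a i + C * K * c i / (1 - \<beta>)
        = (e * E n + 1) * a i + C * K / (1 - \<beta>) * c i" by (simp add: algebra_simps)
      also have "\<dots> \<le> (e * E n + max 1 (C * K / (1 - \<beta>))) * a i + max 1 (C * K / (1 - \<beta>)) * c i"
        using a_nonneg by (intro add_mono[OF mult_right_mono mult_right_mono]) (auto simp: c_def)
      finally show ?thesis by (simp add: prob_A)
    qed
    show "\<exists>N K. K \<ge> 0 \<and> (\<forall>n i. N \<le> i \<longrightarrow> i \<le> n \<longrightarrow>
      (\<Sum>j=i..n. max 0 (prob (A i \<inter> A j) - (prob (A i) + c i) * (prob (A j) + c j)))
        \<le> (e * (\<Sum>j=1..n. prob (A j)) + K) * prob (A i) + K * c i)"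
      by (rule exI[of _ N], rule exI[of _ "max 1 (C * K / (1 - \<beta>))"]) (use row in \<open>auto simp: E_def\<close>)
  qed (auto simp: c_def)
  moreover have "(\<Sum>j=1..n. indicator (A j) x) = (\<Sum>j=1..n. indicator (B j) ((T ^^ j) x) :: real)" for n x
    by (intro sum.cong) (auto simp: A_def B_eq indicator_def)
  moreover have "(\<Sum>j=1..n. prob (A j)) = (\<Sum>j=1..n. prob (B j))" for n
    by (intro sum.cong) (auto simp: prob_A a_def B_eq)
  ultimately show ?thesis by simp
qed

end
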